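(* Consider the optimization problem $$\min_{P}\ J(P,W)=\|W\circ(P-P^0)\|^2\quad\text{s.t.}\quad (P^m_{ij})^2\le\sigma_{ij}^2\ \ \forall (i,j)\in\mathcal{E},\qquad \underline{P}_i\le P_i\le\bar{P}_i\ \ \forall i\in\{1,\dots,n_b\},$$ where $P=(P_1,\dots,P_{n_b})^T$, $P^m_{ij}=e_i^TA^T\mathrm{diag}(Y^m_p)Ae_j\,(e_i-e_j)^T(A^T\mathrm{diag}(Y^m_p)A)^{-1^*}P$, and $Y_p^m$ is the fixed branch admittance vector described in the context. Let $$L(P,\lambda,\tau)=J(P,W)+\sum_{(i,j)\in \mathcal{E}}\lambda_{ij}\left[(P^m_{ij})^2-\sigma_{ij}^2\right]+\sum_{i=1}^{n_b}\bar{\tau}_i(P_i-\bar{P}_i)+\sum_{i=1}^{n_b}\underline{\tau}_i(\underline{P}_i-P_i),$$ with $\tau=(\bar\tau,\underline\tau)$, be the Lagrangian function, and consider the saddle point dynamics $$\dot P=-\nabla_P L(P,\lambda,\tau),\quad \dot\lambda_{ij}=\left[(P^m_{ij})^2-\sigma_{ij}^2\right]^+_{\lambda_{ij}},\quad \dot{\bar\tau}_i=[P_i-\bar P_i]^+_{\bar\tau_i},\quad \dot{\underline\tau}_i=[\underline P_i-P_i]^+_{\underline\tau_i}.$$ Then the saddle point dynamics globally asymptotically converges to the optimal solution of the optimization problem; that is, from every initial condition (with nonnegative multipliers, as the operator $[\,\cdot\,]^+$ requires), $P(t)$ tends to the optimal solution $P^*$ as $t\to\infty$.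
   Context: The operator $[\,\cdot\,]^+$ is defined by $[x]^+_y=x$ if $y>0$ and $[x]^+_y=\max\{x,0\}$ if $y=0$. A power network has $n_b$ buses and $n$ branches, with branch-bus incidence matrix $A\in\mathbb{R}^{n\times n_b}$; branch $l$ connects buses $i_l$ and $j_l$. $\mathcal{E}$ is the set of pairs $(i,j)$ of connected buses. $P^0\in\mathbb{R}^{n_b}$ is the original vector of powers injected on the buses, $P$ is the vector of injected powers after load shedding, $W=(W_1,\dots,W_{n_b})^T$ is a weight vector characterizing the significance of the buses, $\sigma_{ij}$ is the power threshold of the line connecting buses $i$ and $j$, and $\underline P_i,\bar P_i$ are the lower and upper bounds on the injected power at bus $i$. $e_i\in\mathbb{R}^{n_b}$ is the $i$-th standard unit vector, $\mathrm{diag}(x)$ is the diagonal matrix with diagonal $x$, $\circ$ is the Hadamard (entrywise) product, $\|\cdot\|$ is the Euclidean norm. $M\mapsto M^{-1^*}$ is a fixed operator assigning to each (possibly singular) square matrix $M\in\mathbb{R}^{n_b\times n_b}$ a (generalized inverse) matrix in $\mathbb{R}^{n_b\times n_b}$. Cascade. The cascading step number $m$ is fixed. $Y_p^1=Y_p^0+\delta\in\mathbb{R}^n$ is the branch admittance vector after the initial disturbance $\delta$, where $Y_p^0$ is the original one. For $k=1,\dots,m-1$, $Y_p^{k+1}=\mathcal{G}(P^k_{ij})\circ Y_p^k$, where $\mathcal{G}(P^k_{ij})=(g(P^k_{i_1j_1},c_{i_1j_1}),\dots,g(P^k_{i_nj_n},c_{i_nj_n}))^T$ and, since this cascade precedes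 the load shedding, $P^k_{ij}=e_i^TA^T\mathrm{diag}(Y^k_p)Ae_j(e_i-e_j)^T(A^T\mathrm{diag}(Y^k_p)A)^{-1^*}P^0$ for $k\le m-1$. Here $c_{ij}$ is the line's power threshold, $\sigma$ is a tunable parameter ($g$ approaches a step function as $\sigma\to+\infty$), and $g(p,c)=0$ if $|p|\ge\sqrt{c^2+\pi/(2\sigma)}$, $g(p,c)=1$ if $|p|\le\sqrt{c^2-\pi/(2\sigma)}$, and $g(p,c)=\frac12\left(1-\sin(\sigma[p^2-c^2])\right)$ otherwise. Thus $Y_p^m$ does not depend on the decision variable $P$.
   Formalization: The formal theorem assumes that the problem is feasible, that every weight W_i is nonzero (with zero weights the optimum may be non-unique, or P(t) may oscillate forever), and that every power threshold σ_ij is nonzero. *)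

theory Defs
  imports "HOL-Analysis.Analysis"
begin

text \<open>Buses are indexed by a finite type \<open>'b\<close> and branches by a finite type \<open>'n\<close>; branch \<open>l\<close>
  connects the buses \<open>src l\<close> and \<open>tgt l\<close>. The Hadamard product of vectors is the library's
  componentwise multiplication on \<open>real^'b\<close>, and \<open>axis i 1\<close> is the unit vector \<open>e_i\<close>.\<close>

definition incidence_matrix :: "('n::finite \<Rightarrow> 'b::finite) \<Rightarrow> ('n \<Rightarrow> 'b) \<Rightarrow> real^'b^'n" where
  "incidence_matrix src tgt = (\<chi> l i. if i = src l then 1 else if i = tgt l then -1 else 0)"

text \<open>\<open>E\<close> is the set of pairs of connected buses. Each pair may be listed in one order only or in both.\<close>

definition connected_pairs ::
  "('n::finite \<Rightarrow> 'b::finite) \<Rightarrow> ('n \<Rightarrow> 'b) \<Rightarrow> ('b \<times> 'b) set \<Rightarrow> bool" where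
  "connected_pairs src tgt E \<longleftrightarrow>
     (\<forall>(i, j)\<in>E. \<exists>l. {i, j} = {src l, tgt l}) \<and>
     (\<forall>l. (src l, tgt l) \<in> E \<or> (tgt l, src l) \<in> E)"

definition diag_matrix :: "real^'n \<Rightarrow> real^'n^'n::finite" where
  "diag_matrix y = (\<chi> k l. if k = l then y $ k else 0)"

definition nodal_matrix :: "real^'b^'n \<Rightarrow> real^'n \<Rightarrow> real^'b^'b::finite" where
  "nodal_matrix A Y = transpose A ** diag_matrix Y ** A"

text \<open>\<open>ginv\<close> is the operator that assigns a generalized inverse to every square matrix.\<close>

definition line_power ::
  "(real^'b^'b \<Rightarrow> real^'b^'b) \<Rightarrow> real^'b^'n \<Rightarrow> real^'n \<Rightarrow> real^'b::finite \<Rightarrow> 'b \<Rightarrow> 'b \<Rightarrow> real" where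
  "line_power ginv A Y P i j =
     (axis i 1 \<bullet> (nodal_matrix A Y *v axis j 1)) *
     ((axis i 1 - axis j 1) \<bullet> (ginv (nodal_matrix A Y) *v P))"

text \<open>The library's \<open>sqrt\<close> is negative at negative arguments, so for \<open>c\<^sup>2 < pi / (2 * s)\<close>
  the second case never applies.\<close>

definition trip :: "real \<Rightarrow> real \<Rightarrow> real \<Rightarrow> real" where
  "trip s p c =
     (if \<bar>p\<bar> \<ge> sqrt (c\<^sup>2 + pi / (2 * s)) then 0
      else if \<bar>p\<bar> \<le> sqrt (c\<^sup>2 - pi / (2 * s)) then 1
      else (1 - sin (s * (p\<^sup>2 - c\<^sup>2))) / 2)"

text \<open>\<open>admittance \<dots> k\<close> is the branch admittance vector at cascading step \<open>k\<close>; step \<open>0\<close> is the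
  state before the disturbance \<open>d\<close>.\<close>

fun admittance ::
  "(real^'b^'b \<Rightarrow> real^'b^'b) \<Rightarrow> ('n \<Rightarrow> 'b) \<Rightarrow> ('n \<Rightarrow> 'b) \<Rightarrow> ('b \<Rightarrow> 'b \<Rightarrow> real) \<Rightarrow> real \<Rightarrow>
   real^'b \<Rightarrow> real^'n \<Rightarrow> real^'n \<Rightarrow> nat \<Rightarrow> real^('n::finite)" where
  "admittance ginv src tgt c s P0 Y0 d 0 = Y0"
| "admittance ginv src tgt c s P0 Y0 d (Suc 0) = Y0 + d"
| "admittance ginv src tgt c s P0 Y0 d (Suc (Suc k)) =
     (let Y = admittance ginv src tgt c s P0 Y0 d (Suc k) in
      (\<chi> l. trip s (line_power ginv (incidence_matrix src tgt) Y P0 (src l) (tgt l))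
                    (c (src l) (tgt l))) * Y)"

text \<open>In what follows \<open>F P i j\<close> is the power on the line from \<open>i\<close> to \<open>j\<close> when \<open>P\<close> is injected,
  \<open>cap i j\<close> its threshold, and \<open>lo\<close>, \<open>hi\<close> are the bounds on the injected power.\<close>

definition shedding_cost :: "real^'b \<Rightarrow> real^'b \<Rightarrow> real^'b::finite \<Rightarrow> real" where
  "shedding_cost W P0 P = (norm (W * (P - P0)))\<^sup>2"

definition feasible ::
  "('b \<times> 'b) set \<Rightarrow> (real^'b \<Rightarrow> 'b \<Rightarrow> 'b \<Rightarrow> real) \<Rightarrow> ('b \<Rightarrow> 'b \<Rightarrow> real) \<Rightarrow>
   real^'b \<Rightarrow> real^'b \<Rightarrow> real^'b::finite \<Rightarrow> bool" where
  "feasible E F cap lo hi P \<longleftrightarrow>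
     (\<forall>(i, j)\<in>E. (F P i j)\<^sup>2 \<le> (cap i j)\<^sup>2) \<and> (\<forall>i. lo $ i \<le> P $ i \<and> P $ i \<le> hi $ i)"

definition lagrangian ::
  "('b \<times> 'b) set \<Rightarrow> (real^'b \<Rightarrow> 'b \<Rightarrow> 'b \<Rightarrow> real) \<Rightarrow> ('b \<Rightarrow> 'b \<Rightarrow> real) \<Rightarrow>
   real^'b \<Rightarrow> real^'b \<Rightarrow> real^'b \<Rightarrow> real^'b \<Rightarrow>
   real^'b \<Rightarrow> ('b \<Rightarrow> 'b \<Rightarrow> real) \<Rightarrow> real^'b \<Rightarrow> real^'b::finite \<Rightarrow> real" where
  "lagrangian E F cap lo hi W P0 P lam tau_hi tau_lo =
     shedding_cost W P0 P
     + (\<Sum>(i, j)\<in>E. lam i j * ((F P i j)\<^sup>2 - (cap i j)\<^sup>2))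
     + (\<Sum>i\<in>UNIV. tau_hi $ i * (P $ i - hi $ i))
     + (\<Sum>i\<in>UNIV. tau_lo $ i * (lo $ i - P $ i))"

definition gradient :: "('a::real_inner \<Rightarrow> real) \<Rightarrow> 'a \<Rightarrow> 'a" where
  "gradient f x = (THE D. GDERIV f x :> D)"

text \<open>The operator \<open>[x]\<^sup>+\<close> with subscript \<open>y\<close> is meant for \<open>y \<ge> 0\<close>. The value chosen here for \<open>y < 0\<close>
  is nonnegative, so a multiplier that starts nonnegative stays nonnegative.\<close>

definition plus_proj :: "real \<Rightarrow> real \<Rightarrow> real" where
  "plus_proj x y = (if y > 0 then x else max x 0)"

text \<open>The right-hand side of the saddle point dynamics is discontinuous in the multipliers, so
  solutions are taken in the sense of Caratheodory: \<open>x\<close> is locally absolutely continuous on the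
  half-line with derivative \<open>v\<close> almost everywhere, that is, \<open>x\<close> is an indefinite Lebesgue
  integral of \<open>v\<close>.\<close>

definition has_velocity :: "(real \<Rightarrow> 'a::euclidean_space) \<Rightarrow> (real \<Rightarrow> 'a) \<Rightarrow> bool" where
  "has_velocity x v \<longleftrightarrow>
     (\<forall>t\<ge>0. v absolutely_integrable_on {0..t} \<and> x t = x 0 + integral {0..t} v)"

definition saddle_point_dynamics ::
  "('b \<times> 'b) set \<Rightarrow> (real^'b \<Rightarrow> 'b \<Rightarrow> 'b \<Rightarrow> real) \<Rightarrow> ('b \<Rightarrow> 'b \<Rightarrow> real) \<Rightarrow>
   real^'b \<Rightarrow> real^'b \<Rightarrow> real^'b \<Rightarrow> real^'b \<Rightarrow>
   (real \<Rightarrow> real^'b) \<Rightarrow> (real \<Rightarrow> 'b \<Rightarrow> 'b \<Rightarrow> real) \<Rightarrow> (real \<Rightarrow> real^'b) \<Rightarrow>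
   (real \<Rightarrow> real^'b::finite) \<Rightarrow> bool" where
  "saddle_point_dynamics E F cap lo hi W P0 P lam tau_hi tau_lo \<longleftrightarrow>
     has_velocity P
       (\<lambda>t. - gradient (\<lambda>Q. lagrangian E F cap lo hi W P0 Q (lam t) (tau_hi t) (tau_lo t)) (P t)) \<and>
     (\<forall>(i, j)\<in>E. has_velocity (\<lambda>t. lam t i j)
       (\<lambda>t. plus_proj ((F (P t) i j)\<^sup>2 - (cap i j)\<^sup>2) (lam t i j))) \<and>
     (\<forall>i. has_velocity (\<lambda>t. tau_hi t $ i) (\<lambda>t. plus_proj (P t $ i - hi $ i) (tau_hi t $ i))) \<and>
     (\<forall>i. has_velocity (\<lambda>t. tau_lo t $ i) (\<lambda>t. plus_proj (lo $ i - P t $ i) (tau_lo t $ i)))"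

end

theory Submission
  imports Defs
begin

text \<open>Every line power \<open>F P i j\<close> is a linear functional \<open>a i j \<bullet> P\<close>, because the cascade fixes the
  admittances before \<open>P\<close> is chosen. So the problem minimises a strongly convex quadratic under
  finitely many convex constraints, and the dynamics are the projected primal-dual flow of a convex
  program.

  Let \<open>c\<close> be the minimiser, \<open>u\<close> a vector of Karush-Kuhn-Tucker multipliers for it, and
  \<open>V = (norm (x - c))\<^sup>2 / 2 + (\<Sum>k. (lam k - u k)\<^sup>2 / 2)\<close>. Convexity of the constraints makes the
  primal and the dual contributions to the velocity of \<open>V\<close> cancel up to terms of the right sign, the
  projection \<open>plus_proj\<close> only helps (\<open>plus_proj_mult_le\<close>), and strong convexity leaves a velocity of at
  most \<open>- \<mu> * (norm (x - c))\<^sup>2\<close>. Hence \<open>V\<close> decreases, all states stay bounded, \<open>x\<close> is Lipschitz, and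
  a Barbalat argument forces \<open>x\<close> to converge to \<open>c\<close>
  (\<open>dissipation_imp_tendsto\<close>, \<open>saddle_point_flow_converges\<close>). The multipliers \<open>lam\<close> need not approach
  \<open>u\<close>, and \<open>u\<close> need not be unique.

  The existence of \<open>u\<close> cannot rest on Slater's condition: the feasible set may have empty interior,
  for instance when \<open>lo\<close> and \<open>hi\<close> agree at a bus. What saves the argument is that the feasible set
  is a polyhedron, described by \<open>(a \<bullet> P)\<^sup>2 \<le> cap\<^sup>2\<close> with \<open>cap \<noteq> 0\<close>: where such a constraint is active its
  gradient is a nonzero multiple of \<open>a\<close>, so every direction that satisfies the linearised
  constraints is feasible for a short while (\<open>constraint_qualification\<close>). With Farkas' lemma this
  yields the multipliers (\<open>kkt_multipliers\<close>).\<close>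

section \<open>Indefinite Lebesgue integrals\<close>

lemma has_velocityD:
  assumes "has_velocity x v" "0 \<le> s" "s \<le> t"
  shows "v absolutely_integrable_on {s..t}" "v integrable_on {s..t}" "x t - x s = integral {s..t} v"
proof -
  have t: "v absolutely_integrable_on {0..t}" and x: "x t = x 0 + integral {0..t} v"
    using assms unfolding has_velocity_def by (meson order_trans)+
  have xs: "x s = x 0 + integral {0..s} v" using assms unfolding has_velocity_def by meson
  show a: "v absolutely_integrable_on {s..t}"
    by (rule absolutely_integrable_on_subinterval[OF t]) (use assms(2) in auto)
  then show "v integrable_on {s..t}" by (rule set_lebesgue_integral_eq_integral(1))
  have "integral {0..s} v + integral {s..t} v = integral {0..t} v"
    using assms set_lebesgue_integral_eq_integral(1)[OF t]
    by (intro Henstock_Kurzweil_Integration.integral_combine) auto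
  then show "x t - x s = integral {s..t} v" using x xs by (simp add: algebra_simps)
qed

lemma has_velocity_continuous_on:
  assumes "has_velocity x v"
  shows "continuous_on {0..t} x"
proof (cases "t \<ge> 0")
  case True
  have "continuous_on {0..t} (\<lambda>r. x 0 + integral {0..r} v)"
    using has_velocityD(2)[OF assms _ True] by (intro continuous_intros indefinite_integral_continuous_1) auto
  then show ?thesis
    by (rule continuous_on_eq) (use assms in \<open>metis atLeastAtMost_iff has_velocity_def\<close>)
qed auto

lemma has_velocity_add:
  assumes "has_velocity x v" "has_velocity y w"
  shows "has_velocity (\<lambda>t. x t + y t) (\<lambda>t. v t + w t)"
  unfolding has_velocity_def
proof (intro allI impI conjI)
  fix t :: real assume t: "t \<ge> 0"
  show "(\<lambda>t. v t + w t) absolutely_integrable_on {0..t}"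
    using has_velocityD(1)[OF assms(1) _ t] has_velocityD(1)[OF assms(2) _ t]
    by (intro set_integral_add) auto
  have "integral {0..t} (\<lambda>t. v t + w t) = integral {0..t} v + integral {0..t} w"
    using has_velocityD(2)[OF assms(1) _ t] has_velocityD(2)[OF assms(2) _ t]
    by (intro Henstock_Kurzweil_Integration.integral_add) auto
  then show "x t + y t = x 0 + y 0 + integral {0..t} (\<lambda>t. v t + w t)"
    using has_velocityD(3)[OF assms(1) _ t] has_velocityD(3)[OF assms(2) _ t]
    by (simp add: algebra_simps)
qed

lemma has_velocity_sum:
  assumes "finite K" "\<And>k. k \<in> K \<Longrightarrow> has_velocity (x k) (v k)"
  shows "has_velocity (\<lambda>t. \<Sum>k\<in>K. x k t) (\<lambda>t. \<Sum>k\<in>K. v k t)"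
  using assms
proof (induction K rule: finite_induct)
  case empty
  then show ?case by (simp add: has_velocity_def set_integrable_def)
next
  case (insert k K)
  then show ?case by (simp add: has_velocity_add)
qed

lemma has_velocity_norm_le:
  assumes v: "has_velocity x v" and st: "0 \<le> s" "s \<le> t" and B: "\<And>r. r \<in> {s..t} \<Longrightarrow> norm (v r) \<le> B"
  shows "norm (x t - x s) \<le> B * (t - s)"
proof -
  have "norm (integral {s..t} v) \<le> integral {s..t} (\<lambda>_. B)"
    using has_velocityD(2)[OF v st] B by (intro integral_norm_bound_integral) auto
  then show ?thesis using has_velocityD(3)[OF v st] st by (simp add: mult.commute)
qed

text \<open>A bound \<open>C * (t - r)\<^sup>2\<close> on all increments makes the derivative vanish everywhere.\<close>
lemma quadratic_increments_imp_constant: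
  fixes f :: "real \<Rightarrow> real"
  assumes "\<And>r t. 0 \<le> r \<Longrightarrow> r \<le> t \<Longrightarrow> t \<le> T \<Longrightarrow> \<bar>f t - f r\<bar> \<le> C * (t - r)\<^sup>2" and "T \<ge> 0"
  shows "f T = f 0"
proof -
  have inc: "\<bar>f t - f r\<bar> \<le> C * (t - r)\<^sup>2" if "r \<in> {0..T}" "t \<in> {0..T}" for r t
    using assms(1)[of r t] assms(1)[of t r] that
    by (cases "r \<le> t") (auto simp: abs_minus_commute power2_commute)
  have "(f has_field_derivative 0) (at r within {0..T})" if r: "r \<in> {0..T}" for r
    unfolding has_field_derivative_iff
  proof (rule Lim_null_comparison)
    show "\<forall>\<^sub>F t in at r within {0..T}. norm ((f t - f r) / (t - r)) \<le> C * \<bar>t - r\<bar>"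
      unfolding eventually_at_filter
    proof (rule always_eventually, intro allI impI)
      fix t assume t: "t \<noteq> r" "t \<in> {0..T}"
      have "\<bar>f t - f r\<bar> \<le> C * \<bar>t - r\<bar> * \<bar>t - r\<bar>"
        using inc[OF r t(2)] by (simp add: power2_eq_square mult.assoc)
      then show "norm ((f t - f r) / (t - r)) \<le> C * \<bar>t - r\<bar>"
        using t by (simp add: abs_divide pos_divide_le_eq)
    qed
    show "((\<lambda>t. C * \<bar>t - r\<bar>) \<longlongrightarrow> 0) (at r within {0..T})"
      by (auto intro!: tendsto_eq_intros)
  qed
  then obtain c where "\<forall>x\<in>{0..T}. f x = c"
    using has_field_derivative_zero_constant[of "{0..T}" f] by auto
  then show ?thesis using assms(2) by auto
qed

text \<open>The chain rule for the energy along a Caratheodory solution. It avoids almost everywhere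
  differentiation: over \<open>{r..t}\<close> the increment of \<open>(norm (x t - c))\<^sup>2 / 2\<close> is the integral of
  \<open>mid \<bullet> v\<close>, where \<open>mid\<close> is the midpoint \<open>(x t + x r) / 2 - c\<close>. If \<open>v\<close> is bounded then \<open>mid\<close> differs from
  \<open>x q - c\<close> by \<open>O(t - r)\<close>, so the energy and the claimed integral have increments that differ by
  \<open>O((t - r)\<^sup>2)\<close>.\<close>
lemma has_velocity_half_norm_square:
  fixes x v :: "real \<Rightarrow> 'a::euclidean_space"
  assumes v: "has_velocity x v" and bdd: "\<And>t. t \<ge> 0 \<Longrightarrow> bounded (v ` {0..t})"
  shows "has_velocity (\<lambda>t. (norm (x t - c))\<^sup>2 / 2) (\<lambda>t. (x t - c) \<bullet> v t)"
  unfolding has_velocity_def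
proof (intro allI impI conjI)
  fix T :: real assume T: "T \<ge> 0"
  have cont: "continuous_on {0..t} (\<lambda>t. x t - c)" for t
    using has_velocity_continuous_on[OF v] by (intro continuous_intros)
  have ai: "(\<lambda>t. (x t - c) \<bullet> v t) absolutely_integrable_on {0..t}" if "t \<ge> 0" for t
  proof (rule absolutely_integrable_bounded_measurable_product[where h = "(\<bullet>)"])
    show "bilinear ((\<bullet>) :: 'a \<Rightarrow> 'a \<Rightarrow> real)"
      by (simp add: bilinear_conv_bounded_bilinear bounded_bilinear_inner)
    show "(\<lambda>t. x t - c) \<in> borel_measurable (lebesgue_on {0..t})"
      using cont by (intro continuous_imp_measurable_on_sets_lebesgue) auto
    show "bounded ((\<lambda>t. x t - c) ` {0..t})"
      using cont by (intro compact_imp_bounded compact_continuous_image) auto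
    show "v absolutely_integrable_on {0..t}" using has_velocityD(1)[OF v _ that] by auto
  qed auto
  then show "(\<lambda>t. (x t - c) \<bullet> v t) absolutely_integrable_on {0..T}" using T .
  have int: "(\<lambda>t. (x t - c) \<bullet> v t) integrable_on {r..t}" if "0 \<le> r" "r \<le> t" for r t
    using absolutely_integrable_on_subinterval[OF ai, of t r t] that
    by (auto dest: set_lebesgue_integral_eq_integral(1))
  obtain B where B: "B > 0" "\<And>t. t \<in> {0..T} \<Longrightarrow> norm (v t) \<le> B"
    using bdd[OF T] unfolding bounded_pos by auto
  define D where "D t = (norm (x t - c))\<^sup>2 / 2 - integral {0..t} (\<lambda>t. (x t - c) \<bullet> v t)" for t
  have "D T = D 0"
  proof (rule quadratic_increments_imp_constant[where C = "B\<^sup>2"])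
    fix r t assume rt: "0 \<le> r" "r \<le> t" "t \<le> T"
    define mid where "mid = (1/2) *\<^sub>R (x t + x r) - c"
    have vi: "v integrable_on {r..t}" and xi: "x t - x r = integral {r..t} v"
      using has_velocityD[OF v rt(1,2)] by auto
    have lip: "norm (x q - x p) \<le> B * (t - r)" if "r \<le> p" "p \<le> q" "q \<le> t" for p q
    proof -
      have "norm (x q - x p) \<le> B * (q - p)"
        using that rt B by (intro has_velocity_norm_le[OF v]) auto
      also have "\<dots> \<le> B * (t - r)" using that B by (intro mult_left_mono) auto
      finally show ?thesis .
    qed
    have "(norm (x t - c))\<^sup>2 / 2 - (norm (x r - c))\<^sup>2 / 2 = mid \<bullet> (x t - x r)"
      unfolding mid_def power2_norm_eq_inner
      by (simp add: inner_simps inner_commute field_simps)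
    also have "\<dots> = integral {r..t} (\<lambda>q. mid \<bullet> v q)"
      unfolding xi using integral_linear[OF vi bounded_linear_inner_right[of mid]] by (simp add: o_def)
    finally have sq: "(norm (x t - c))\<^sup>2 / 2 - (norm (x r - c))\<^sup>2 / 2 = integral {r..t} (\<lambda>q. mid \<bullet> v q)" .
    have mi: "(\<lambda>q. mid \<bullet> v q) integrable_on {r..t}"
      using integrable_linear[OF vi bounded_linear_inner_right[of mid]] by (simp add: o_def)
    have "integral {0..r} (\<lambda>t. (x t - c) \<bullet> v t) + integral {r..t} (\<lambda>t. (x t - c) \<bullet> v t)
        = integral {0..t} (\<lambda>t. (x t - c) \<bullet> v t)"
      using rt int[of 0 t] by (intro Henstock_Kurzweil_Integration.integral_combine) auto
    then have "D t - D r = integral {r..t} (\<lambda>q. mid \<bullet> v q - (x q - c) \<bullet> v q)"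
      unfolding D_def using sq Henstock_Kurzweil_Integration.integral_diff[OF mi int[OF rt(1,2)]] by simp
    moreover have "norm (integral {r..t} (\<lambda>q. mid \<bullet> v q - (x q - c) \<bullet> v q)) \<le> integral {r..t} (\<lambda>_. B\<^sup>2 * (t - r))"
    proof (rule integral_norm_bound_integral)
      show "(\<lambda>q. mid \<bullet> v q - (x q - c) \<bullet> v q) integrable_on {r..t}"
        using mi int[OF rt(1,2)] by (rule integrable_diff)
      fix q assume q: "q \<in> {r..t}"
      have "mid - (x q - c) = (1/2) *\<^sub>R (x t - x q) - (1/2) *\<^sub>R (x q - x r)"
        unfolding mid_def by (simp add: algebra_simps flip: scaleR_add_left)
      also have "norm \<dots> \<le> norm ((1/2) *\<^sub>R (x t - x q)) + norm ((1/2) *\<^sub>R (x q - x r))"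
        by (rule norm_triangle_ineq4)
      also have "\<dots> \<le> B * (t - r)" using lip[of q t] lip[of r q] q by simp
      finally have "norm (mid - (x q - c)) * norm (v q) \<le> (B * (t - r)) * B"
        using B q rt by (intro mult_mono) auto
      then have "norm ((mid - (x q - c)) \<bullet> v q) \<le> (B * (t - r)) * B"
        using Cauchy_Schwarz_ineq2[of "mid - (x q - c)" "v q"] by simp
      then show "norm (mid \<bullet> v q - (x q - c) \<bullet> v q) \<le> B\<^sup>2 * (t - r)"
        by (simp add: inner_diff_left power2_eq_square mult_ac)
    qed auto
    ultimately show "\<bar>D t - D r\<bar> \<le> B\<^sup>2 * (t - r)\<^sup>2"
      using rt by (simp add: power2_eq_square mult_ac)
  qed (use T in auto)
  then show "(norm (x T - c))\<^sup>2 / 2 = (norm (x 0 - c))\<^sup>2 / 2 + integral {0..T} (\<lambda>t. (x t - c) \<bullet> v t)"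
    unfolding D_def by simp
qed

text \<open>From the last time at which \<open>y\<close> was nonnegative up to \<open>t\<close> the velocity would be nonnegative, so \<open>y\<close>
  cannot have become negative.\<close>
lemma has_velocity_nonneg:
  fixes y v :: "real \<Rightarrow> real"
  assumes v: "has_velocity y v" and init: "y 0 \<ge> 0"
    and barrier: "\<And>t. t \<ge> 0 \<Longrightarrow> y t < 0 \<Longrightarrow> v t \<ge> 0" and t: "t \<ge> 0"
  shows "y t \<ge> 0"
proof (rule ccontr)
  assume neg: "\<not> y t \<ge> 0"
  define S where "S = {r \<in> {0..t}. y r \<ge> 0}"
  have "closed S"
    unfolding S_def using has_velocity_continuous_on[OF v, of t]
    by (intro continuous_on_closed_Collect_le continuous_intros) auto
  moreover have ne: "S \<noteq> {}" "bdd_above S" using init t unfolding S_def by auto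
  ultimately have "Sup S \<in> S" by (intro closed_contains_Sup) auto
  then have s: "0 \<le> Sup S" "Sup S \<le> t" "y (Sup S) \<ge> 0" unfolding S_def by auto
  \<comment> \<open>At the endpoint \<open>Sup S\<close> itself \<open>y\<close> is nonnegative and \<open>v\<close> may have either sign.\<close>
  define w where "w r = (if r = Sup S then 0 else v r)" for r
  have "w r \<ge> 0" if r: "r \<in> {Sup S..t}" for r
  proof (cases "r = Sup S")
    case False
    then have "r \<notin> S" using cSup_upper[of r S] ne r by auto
    then show ?thesis using barrier[of r] False r s unfolding S_def w_def by auto
  qed (simp add: w_def)
  moreover have "w integrable_on {Sup S..t}"
    by (rule integrable_spike[OF has_velocityD(2)[OF v s(1,2)], of "{Sup S}"]) (auto simp: w_def)
  ultimately have "integral {Sup S..t} w \<ge> 0" by (intro Henstock_Kurzweil_Integration.integral_nonneg) auto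
  also have "integral {Sup S..t} w = integral {Sup S..t} v"
    by (rule integral_spike[of "{Sup S}"]) (auto simp: w_def)
  finally have "integral {Sup S..t} v \<ge> 0" .
  then show False using has_velocityD(3)[OF v s(1,2)] s neg by simp
qed

section \<open>Multipliers from a polyhedral constraint qualification\<close>

text \<open>Farkas' lemma. The cone generated by finitely many vectors is closed, so a point \<open>z\<close> outside it
  could be separated from it by a hyperplane, whose normal would violate the dual condition.\<close>
lemma farkas_finite:
  fixes G :: "'k \<Rightarrow> 'a::euclidean_space"
  assumes fin: "finite K" and dual: "\<And>d. (\<And>k. k \<in> K \<Longrightarrow> d \<bullet> G k \<le> 0) \<Longrightarrow> d \<bullet> z \<le> 0"
  obtains u where "\<And>k. u k \<ge> 0" "z = (\<Sum>k\<in>K. u k *\<^sub>R G k)"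
proof -
  define C where "C = convex_cone hull (G ` K)"
  have cone: "conic C" and cl: "closed C" and conv: "convex C" and zero: "0 \<in> C"
    unfolding C_def using fin
    by (auto intro: conic_convex_cone_hull closed_convex_cone_hull convex_convex_cone_hull
        convex_cone_hull_contains_0)
  have "z \<in> C"
  proof (rule ccontr)
    assume "z \<notin> C"
    then obtain a b where ab: "a \<bullet> z < b" "\<And>y. y \<in> C \<Longrightarrow> a \<bullet> y > b"
      using separating_hyperplane_closed_point[OF conv cl] by blast
    have b: "b < 0" using ab(2)[OF zero] by simp
    have "a \<bullet> y \<ge> 0" if y: "y \<in> C" for y
    proof (rule ccontr)
      assume neg: "\<not> a \<bullet> y \<ge> 0"
      have "(b / (a \<bullet> y)) *\<^sub>R y \<in> C"
        using neg b by (intro conicD[OF cone y]) (auto simp: divide_nonpos_neg)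
      from ab(2)[OF this] neg show False by simp
    qed
    then have "(- a) \<bullet> G k \<le> 0" if "k \<in> K" for k
      using that unfolding C_def by (simp add: hull_inc)
    from dual[OF this] ab(1) b show False by simp
  qed
  also have "C \<subseteq> {\<Sum>k\<in>K. u k *\<^sub>R G k | u. \<forall>k. u k \<ge> 0}" (is "_ \<subseteq> ?S")
    unfolding C_def
  proof (rule hull_minimal)
    show "G ` K \<subseteq> ?S"
    proof
      fix y assume "y \<in> G ` K"
      then obtain k where k: "k \<in> K" "y = G k" by auto
      have "y = (\<Sum>l\<in>K. (if l = k then 1 else 0) *\<^sub>R G l)"
        using k fin by (simp add: if_distrib[of "\<lambda>c. c *\<^sub>R _"] sum.delta cong: if_cong)
      then show "y \<in> ?S" by (intro CollectI exI[of _ "\<lambda>l. if l = k then 1 else 0"]) auto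
    qed
    show "convex_cone ?S"
      unfolding convex_cone_iff
    proof (intro conjI ballI allI impI)
      show "0 \<in> ?S" by (intro CollectI exI[of _ "\<lambda>_. 0"]) auto
    next
      fix y y' assume "y \<in> ?S" "y' \<in> ?S"
      then obtain u u' where "y = (\<Sum>k\<in>K. u k *\<^sub>R G k)" "y' = (\<Sum>k\<in>K. u' k *\<^sub>R G k)"
        "\<forall>k. u k \<ge> 0" "\<forall>k. u' k \<ge> 0" by auto
      then show "y + y' \<in> ?S"
        by (intro CollectI exI[of _ "\<lambda>k. u k + u' k"]) (auto simp: scaleR_add_left sum.distrib)
    next
      fix y and c :: real assume "y \<in> ?S" "c \<ge> 0"
      then obtain u where "y = (\<Sum>k\<in>K. u k *\<^sub>R G k)" "\<forall>k. u k \<ge> 0" by auto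
      then show "c *\<^sub>R y \<in> ?S"
        using \<open>c \<ge> 0\<close> by (intro CollectI exI[of _ "\<lambda>k. c * u k"]) (auto simp: scaleR_sum_right)
    qed
  qed
  finally show thesis using that by blast
qed

text \<open>If the negative gradient were not in the cone of the active constraint gradients, Farkas' lemma
  would give a descent direction that satisfies the linearised active constraints. The qualification
  makes that direction feasible for small steps, which contradicts minimality.\<close>
lemma kkt_multipliers:
  fixes x :: "'a::euclidean_space" and g :: "'k \<Rightarrow> 'a \<Rightarrow> real"
  assumes fin: "finite K"
    and feas: "\<And>k. k \<in> K \<Longrightarrow> g k x \<le> 0"
    and minimal: "\<And>y. (\<And>k. k \<in> K \<Longrightarrow> g k y \<le> 0) \<Longrightarrow> J x \<le> J y"
    and deriv: "GDERIV J x :> DJ"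
    and cont: "\<And>k. k \<in> K \<Longrightarrow> isCont (g k) x"
    and qualification: "\<And>k d. k \<in> K \<Longrightarrow> g k x = 0 \<Longrightarrow> d \<bullet> Dg k \<le> 0 \<Longrightarrow>
      \<forall>\<^sub>F h in at_right 0. g k (x + h *\<^sub>R d) \<le> 0"
  obtains u where "\<And>k. u k \<ge> 0" "\<And>k. k \<in> K \<Longrightarrow> u k * g k x = 0" "DJ + (\<Sum>k\<in>K. u k *\<^sub>R Dg k) = 0"
proof -
  define A where "A = {k \<in> K. g k x = 0}"
  have "d \<bullet> (- DJ) \<le> 0" if d: "\<And>k. k \<in> A \<Longrightarrow> d \<bullet> Dg k \<le> 0" for d
  proof (rule ccontr)
    assume "\<not> d \<bullet> (- DJ) \<le> 0"
    then have neg: "d \<bullet> DJ < 0" by simp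
    have "((\<lambda>h. J (x + h *\<^sub>R d)) has_derivative (\<lambda>h. (h *\<^sub>R d) \<bullet> DJ)) (at 0)"
      by (rule has_derivative_compose[where g = J, where f = "\<lambda>h. x + h *\<^sub>R d", unfolded o_def])
        (use deriv in \<open>auto intro!: derivative_eq_intros simp: gderiv_def\<close>)
    then have "((\<lambda>h. J (x + h *\<^sub>R d)) has_field_derivative (d \<bullet> DJ)) (at 0)"
      by (simp add: has_field_derivative_def mult_commute_abs)
    from DERIV_neg_dec_right[OF this neg]
    obtain \<delta> where "\<delta> > 0" "\<And>h. 0 < h \<Longrightarrow> h < \<delta> \<Longrightarrow> J (x + h *\<^sub>R d) < J x" by auto
    then have dec: "\<forall>\<^sub>F h in at_right 0. J (x + h *\<^sub>R d) < J x"
      unfolding eventually_at_right_field by (intro exI[of _ \<delta>]) auto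
    have "\<forall>\<^sub>F h in at_right 0. g k (x + h *\<^sub>R d) \<le> 0" if k: "k \<in> K" for k
    proof (cases "g k x = 0")
      case True
      then show ?thesis using qualification d k unfolding A_def by auto
    next
      case False
      then have lt: "g k x < 0" using feas[OF k] by simp
      have "isCont (\<lambda>h. g k (x + h *\<^sub>R d)) 0"
        by (rule isCont_o2[where g = "g k"]) (use cont[OF k] in \<open>auto intro!: continuous_intros\<close>)
      then have "((\<lambda>h. g k (x + h *\<^sub>R d)) \<longlongrightarrow> g k x) (at_right 0)"
        unfolding isCont_def using tendsto_within_subset[of _ _ 0 UNIV] by auto
      from order_tendstoD(2)[OF this lt] show ?thesis by eventually_elim simp
    qed
    then have "\<forall>\<^sub>F h in at_right 0. \<forall>k\<in>K. g k (x + h *\<^sub>R d) \<le> 0"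
      using fin by (intro eventually_ball_finite) auto
    with dec have "\<forall>\<^sub>F h in at_right (0::real). False"
    proof eventually_elim
      case (elim h)
      then show ?case using minimal[of "x + h *\<^sub>R d"] by auto
    qed
    then show False by (simp add: trivial_limit_at_right_real flip: trivial_limit_def)
  qed
  moreover have "finite A" using fin unfolding A_def by auto
  ultimately obtain u where u: "\<And>k. u k \<ge> 0" "- DJ = (\<Sum>k\<in>A. u k *\<^sub>R Dg k)"
    using farkas_finite[of A Dg "- DJ"] by metis
  show thesis
  proof (rule that[of "\<lambda>k. if k \<in> A then u k else 0"])
    have "(\<Sum>k\<in>K. (if k \<in> A then u k else 0) *\<^sub>R Dg k) = (\<Sum>k\<in>A. u k *\<^sub>R Dg k)"
      using fin by (intro sum.mono_neutral_cong_right) (auto simp: A_def)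
    then show "DJ + (\<Sum>k\<in>K. (if k \<in> A then u k else 0) *\<^sub>R Dg k) = 0"
      by (simp flip: u(2))
  qed (use u in \<open>auto simp: A_def\<close>)
qed

text \<open>With this, a strictly convex objective has only one minimiser.\<close>
lemma kkt_imp_variational_inequality:
  fixes x y :: "'a::real_inner"
  assumes conv: "\<And>k. k \<in> K \<Longrightarrow> g k y \<ge> g k x + Dg k \<bullet> (y - x)"
    and feas: "\<And>k. k \<in> K \<Longrightarrow> g k y \<le> 0"
    and kkt: "\<And>k. u k \<ge> 0" "\<And>k. k \<in> K \<Longrightarrow> u k * g k x = 0" "DJ + (\<Sum>k\<in>K. u k *\<^sub>R Dg k) = 0"
  shows "DJ \<bullet> (y - x) \<ge> 0"
proof -
  have "(\<Sum>k\<in>K. u k * (Dg k \<bullet> (y - x))) \<le> 0"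
  proof (rule sum_nonpos)
    fix k assume k: "k \<in> K"
    have "u k * (Dg k \<bullet> (y - x)) \<le> u k * (g k y - g k x)"
      using conv[OF k] kkt(1) by (intro mult_left_mono) auto
    also have "\<dots> \<le> 0"
      using kkt(1) kkt(2)[OF k] feas[OF k] unfolding right_diff_distrib
      by (simp only: mult_nonneg_nonpos diff_zero)
    finally show "u k * (Dg k \<bullet> (y - x)) \<le> 0" .
  qed
  moreover have "(DJ + (\<Sum>k\<in>K. u k *\<^sub>R Dg k)) \<bullet> (y - x) = 0" using kkt(3) by simp
  ultimately show ?thesis by (simp add: inner_add_left inner_sum_left)
qed

section \<open>Convergence of projected saddle point flows\<close>

text \<open>Barbalat's argument. If \<open>x\<close> is at distance \<open>\<epsilon>\<close> from \<open>c\<close> at some time, then by the Lipschitz bound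
  it stays \<open>\<epsilon> / 2\<close> away for a time \<open>\<delta>\<close> that depends on \<open>\<epsilon>\<close> only, and \<open>V\<close> loses a fixed amount \<open>\<eta>\<close>. Once
  \<open>V\<close> is within \<open>\<eta>\<close> of its infimum this cannot happen any more.\<close>
lemma dissipation_imp_tendsto:
  fixes x :: "real \<Rightarrow> 'a::euclidean_space"
  assumes lip: "\<And>s t. 0 \<le> s \<Longrightarrow> s \<le> t \<Longrightarrow> norm (x t - x s) \<le> B * (t - s)"
    and V: "has_velocity V w" "\<And>t. t \<ge> 0 \<Longrightarrow> V t \<ge> 0"
    and dissip: "\<And>t. t \<ge> 0 \<Longrightarrow> w t \<le> - \<mu> * (norm (x t - c))\<^sup>2" and \<mu>: "\<mu> > 0"
  shows "(x \<longlongrightarrow> c) at_top"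
proof (rule tendstoI)
  fix \<epsilon> :: real assume \<epsilon>: "\<epsilon> > 0"
  have decay: "V t \<le> V s - \<mu> * \<rho>\<^sup>2 * (t - s)"
    if st: "0 \<le> s" "s \<le> t" and "\<rho> \<ge> 0" and far: "\<And>r. r \<in> {s..t} \<Longrightarrow> norm (x r - c) \<ge> \<rho>" for s t \<rho>
  proof -
    have "integral {s..t} w \<le> integral {s..t} (\<lambda>_. - \<mu> * \<rho>\<^sup>2)"
    proof (rule integral_le)
      fix r assume r: "r \<in> {s..t}"
      have "\<mu> * \<rho>\<^sup>2 \<le> \<mu> * (norm (x r - c))\<^sup>2"
        using far[OF r] \<open>\<rho> \<ge> 0\<close> \<mu> by (intro mult_left_mono power_mono) auto
      then show "w r \<le> - \<mu> * \<rho>\<^sup>2" using dissip[of r] r st by auto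
    qed (use has_velocityD(2)[OF V(1) st] in auto)
    then show ?thesis using has_velocityD(3)[OF V(1) st] st by (simp add: algebra_simps)
  qed
  \<comment> \<open>Adding \<open>1\<close> avoids a division by zero when \<open>B = 0\<close>.\<close>
  define \<delta> where "\<delta> = \<epsilon> / (2 * (\<bar>B\<bar> + 1))"
  have \<delta>: "\<delta> > 0" "\<bar>B\<bar> * \<delta> \<le> \<epsilon> / 2"
    unfolding \<delta>_def using \<epsilon> by (auto simp: field_simps)
  define \<eta> where "\<eta> = \<mu> * (\<epsilon> / 2)\<^sup>2 * \<delta>"
  have \<eta>: "\<eta> > 0" unfolding \<eta>_def using \<mu> \<epsilon> \<delta> by auto
  have bdd: "bdd_below (V ` {0..})" using V(2) by (intro bdd_belowI2[of _ 0]) auto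
  obtain T where T: "T \<ge> 0" "V T < Inf (V ` {0..}) + \<eta>"
    using cInf_lessD[of "V ` {0..}" "Inf (V ` {0..}) + \<eta>"] \<eta> by auto
  have "dist (x t) c < \<epsilon>" if t: "t \<ge> T" for t
  proof (rule ccontr)
    assume "\<not> dist (x t) c < \<epsilon>"
    then have far: "norm (x t - c) \<ge> \<epsilon>" by (simp add: dist_norm)
    have "norm (x r - c) \<ge> \<epsilon> / 2" if r: "r \<in> {t..t + \<delta>}" for r
    proof -
      have "norm (x r - x t) \<le> B * (r - t)" using lip[of t r] r t T by auto
      also have "\<dots> \<le> \<bar>B\<bar> * \<delta>" using r by (intro mult_mono) auto
      finally have "norm (x r - x t) \<le> \<epsilon> / 2" using \<delta> by simp
      moreover have "norm (x t - c) \<le> norm (x r - c) + norm (x r - x t)"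
        using norm_triangle_ineq4[of "x r - c" "x r - x t"] by simp
      ultimately show ?thesis using far by simp
    qed
    then have "V (t + \<delta>) \<le> V t - \<eta>"
      using decay[of t "t + \<delta>" "\<epsilon> / 2"] t T \<delta> \<epsilon> unfolding \<eta>_def by auto
    moreover have "V t \<le> V T" using decay[of T t 0] t T by auto
    moreover have "Inf (V ` {0..}) \<le> V (t + \<delta>)" using t T \<delta> bdd by (intro cInf_lower) auto
    ultimately show False using T by simp
  qed
  then show "\<forall>\<^sub>F t in at_top. dist (x t) c < \<epsilon>" by (rule eventually_at_top_linorderI)
qed

lemma plus_proj_ge: "plus_proj a b \<ge> a"
  by (simp add: plus_proj_def)

text \<open>The projection changes the velocity only at \<open>y = 0\<close>, where it raises it while \<open>y - z \<le> 0\<close>. So it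
  never increases the velocity of the distance from \<open>y\<close> to a nonnegative \<open>z\<close>.\<close>
lemma plus_proj_mult_le:
  assumes "y \<ge> 0" "z \<ge> 0"
  shows "(y - z) * plus_proj a y \<le> (y - z) * a"
proof (cases "y > 0")
  case False
  then have "y = 0" using assms by simp
  then show ?thesis using assms plus_proj_ge[of a y] by (simp add: mult_left_mono)
qed (simp add: plus_proj_def)

text \<open>Only the gradient \<open>DJ\<close> of the objective enters, and strong convexity appears as its strong
  monotonicity. The energy \<open>V\<close> measures the distance to the saddle point \<open>(c, u)\<close>.\<close>
theorem saddle_point_flow_converges:
  fixes x :: "real \<Rightarrow> 'a::euclidean_space" and lam :: "real \<Rightarrow> 'k \<Rightarrow> real"
    and g :: "'k \<Rightarrow> 'a \<Rightarrow> real" and Dg :: "'k \<Rightarrow> 'a \<Rightarrow> 'a"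
  assumes fin: "finite K" and \<mu>: "\<mu> > 0"
    and mono: "\<And>y z. (DJ y - DJ z) \<bullet> (y - z) \<ge> \<mu> * (norm (y - z))\<^sup>2"
    and conv: "\<And>k y z. k \<in> K \<Longrightarrow> g k z \<ge> g k y + Dg k y \<bullet> (z - y)"
    and cont: "continuous_on UNIV DJ" "\<And>k. k \<in> K \<Longrightarrow> continuous_on UNIV (g k)"
      "\<And>k. k \<in> K \<Longrightarrow> continuous_on UNIV (Dg k)"
    and feas: "\<And>k. k \<in> K \<Longrightarrow> g k c \<le> 0"
    and kkt: "\<And>k. u k \<ge> 0" "\<And>k. k \<in> K \<Longrightarrow> u k * g k c = 0" "DJ c + (\<Sum>k\<in>K. u k *\<^sub>R Dg k c) = 0"
    and x: "has_velocity x (\<lambda>t. - (DJ (x t) + (\<Sum>k\<in>K. lam t k *\<^sub>R Dg k (x t))))"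
    and lam: "\<And>k. k \<in> K \<Longrightarrow> has_velocity (\<lambda>t. lam t k) (\<lambda>t. plus_proj (g k (x t)) (lam t k))"
    and init: "\<And>k. k \<in> K \<Longrightarrow> lam 0 k \<ge> 0"
  shows "(x \<longlongrightarrow> c) at_top"
proof -
  have lam_nonneg: "lam t k \<ge> 0" if "k \<in> K" "t \<ge> 0" for k t
    using has_velocity_nonneg[OF lam[OF that(1)] init[OF that(1)] _ that(2)]
    by (auto simp: plus_proj_def)
  have x_cont: "continuous_on {0..t} x" and lam_cont: "k \<in> K \<Longrightarrow> continuous_on {0..t} (\<lambda>t. lam t k)" for t k
    using has_velocity_continuous_on[OF x] has_velocity_continuous_on[OF lam] by auto
  have comp: "continuous_on {0..t} (\<lambda>t. f (x t))" if "continuous_on UNIV f" for t and f :: "'a \<Rightarrow> 'c::real_normed_vector"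
    using continuous_on_compose2[OF that x_cont] by auto

  define vx where "vx t = - (DJ (x t) + (\<Sum>k\<in>K. lam t k *\<^sub>R Dg k (x t)))" for t
  define vl where "vl k t = plus_proj (g k (x t)) (lam t k)" for k t
  have vx_bdd: "bounded (vx ` {0..t})" for t
    unfolding vx_def using comp[OF cont(1)] comp[OF cont(3)] lam_cont
    by (intro compact_imp_bounded compact_continuous_image continuous_intros) auto
  \<comment> \<open>\<open>vl k\<close> jumps with \<open>plus_proj\<close>, so it inherits only boundedness, not continuity.\<close>
  have vl_bdd: "bounded (vl k ` {0..t})" if k: "k \<in> K" for k t
  proof -
    have "bounded ((\<lambda>t. g k (x t)) ` {0..t})"
      using comp[OF cont(2)[OF k]] by (intro compact_imp_bounded compact_continuous_image) auto
    then obtain b where "\<forall>r\<in>{0..t}. \<bar>g k (x r)\<bar> \<le> b"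
      unfolding bounded_iff by auto
    then show ?thesis
      unfolding bounded_iff vl_def plus_proj_def by (intro exI[of _ b]) force
  qed

  define V where "V t = (norm (x t - c))\<^sup>2 / 2 + (\<Sum>k\<in>K. (norm (lam t k - u k))\<^sup>2 / 2)" for t
  define w where "w t = (x t - c) \<bullet> vx t + (\<Sum>k\<in>K. (lam t k - u k) \<bullet> vl k t)" for t
  have V: "has_velocity V w"
    unfolding V_def w_def
    using x lam fin vx_bdd vl_bdd unfolding vx_def[symmetric] vl_def[symmetric]
    by (intro has_velocity_add has_velocity_sum has_velocity_half_norm_square) auto
  have V_nonneg: "V t \<ge> 0" for t unfolding V_def by (intro add_nonneg_nonneg sum_nonneg) auto

  have dissip: "w t \<le> - \<mu> * (norm (x t - c))\<^sup>2" if t: "t \<ge> 0" for t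
  proof -
    have "(x t - c) \<bullet> vx t = - (DJ (x t) \<bullet> (x t - c)) - (\<Sum>k\<in>K. lam t k * (Dg k (x t) \<bullet> (x t - c)))"
      unfolding vx_def inner_commute[of "x t - c"] by (simp add: inner_diff_left inner_sum_left)
    moreover have "(\<Sum>k\<in>K. (lam t k - u k) \<bullet> vl k t)
        \<le> (\<Sum>k\<in>K. lam t k * (Dg k (x t) \<bullet> (x t - c)) - u k * (Dg k c \<bullet> (x t - c)))"
    proof (rule sum_mono)
      fix k assume k: "k \<in> K"
      have "(lam t k - u k) \<bullet> vl k t \<le> (lam t k - u k) * g k (x t)"
        unfolding vl_def using plus_proj_mult_le[OF lam_nonneg[OF k t] kkt(1)[of k]] by simp
      also have "\<dots> = lam t k * g k (x t) - u k * g k (x t)" by (simp add: left_diff_distrib)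
      also have "\<dots> \<le> lam t k * (Dg k (x t) \<bullet> (x t - c)) - u k * (Dg k c \<bullet> (x t - c))"
      proof (rule diff_mono)
        have "g k (x t) \<le> Dg k (x t) \<bullet> (x t - c)"
          using conv[OF k, of "x t" c] feas[OF k] by (simp add: inner_diff_right)
        then show "lam t k * g k (x t) \<le> lam t k * (Dg k (x t) \<bullet> (x t - c))"
          using lam_nonneg[OF k t] by (rule mult_left_mono)
        have "u k * (g k c + Dg k c \<bullet> (x t - c)) \<le> u k * g k (x t)"
          using conv[OF k, of c "x t"] kkt(1) by (intro mult_left_mono) auto
        then show "u k * (Dg k c \<bullet> (x t - c)) \<le> u k * g k (x t)"
          using kkt(2)[OF k] by (simp add: distrib_left)
      qed
      finally show "(lam t k - u k) \<bullet> vl k t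
        \<le> lam t k * (Dg k (x t) \<bullet> (x t - c)) - u k * (Dg k c \<bullet> (x t - c))" .
    qed
    moreover have "(\<Sum>k\<in>K. u k * (Dg k c \<bullet> (x t - c))) = - (DJ c \<bullet> (x t - c))"
    proof -
      have "(DJ c + (\<Sum>k\<in>K. u k *\<^sub>R Dg k c)) \<bullet> (x t - c) = 0" using kkt(3) by simp
      then show ?thesis by (simp add: inner_add_left inner_sum_left)
    qed
    ultimately have "w t \<le> - ((DJ (x t) - DJ c) \<bullet> (x t - c))"
      unfolding w_def by (simp add: sum_subtractf inner_diff_left)
    then show ?thesis using mono[of "x t" c] by simp
  qed

  \<comment> \<open>The sublevel set of \<open>V\<close> gives bounds uniform in time, hence a global Lipschitz constant for \<open>x\<close>.\<close>
  define R where "R = sqrt (2 * V 0)"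
  have V_le: "V t \<le> V 0" if t: "t \<ge> 0" for t
  proof -
    have "w r \<le> 0" if "r \<in> {0..t}" for r
      using dissip[of r] that \<mu> by (auto intro: order_trans)
    then have "integral {0..t} w \<le> integral {0..t} (\<lambda>_. 0)"
      using has_velocityD(2)[OF V _ t] by (intro integral_le) auto
    then show ?thesis using has_velocityD(3)[OF V _ t] by simp
  qed
  have x_bdd: "x t \<in> cball c R" if t: "t \<ge> 0" for t
  proof -
    have "(norm (x t - c))\<^sup>2 / 2 \<le> V t" unfolding V_def by (simp add: sum_nonneg)
    then have "(norm (x t - c))\<^sup>2 \<le> 2 * V 0" using V_le[OF t] by simp
    then show ?thesis unfolding R_def by (simp add: dist_norm norm_minus_commute real_le_rsqrt)
  qed
  have lam_bdd: "\<bar>lam t k\<bar> \<le> u k + R" if k: "k \<in> K" and t: "t \<ge> 0" for k t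
  proof -
    have "(norm (lam t k - u k))\<^sup>2 / 2 \<le> (\<Sum>k\<in>K. (norm (lam t k - u k))\<^sup>2 / 2)"
      using fin k by (intro member_le_sum) auto
    also have "\<dots> \<le> V t" unfolding V_def by simp
    finally have "(norm (lam t k - u k))\<^sup>2 \<le> 2 * V 0" using V_le[OF t] by simp
    then have "\<bar>lam t k - u k\<bar> \<le> R" unfolding R_def by (simp add: real_le_rsqrt)
    then show ?thesis using lam_nonneg[OF k t] by linarith
  qed
  have ball_bdd: "\<exists>b. \<forall>y\<in>cball c R. norm (f y) \<le> b" if "continuous_on UNIV f" for f :: "'a \<Rightarrow> 'a"
  proof -
    have "bounded (f ` cball c R)"
      using that by (intro compact_imp_bounded compact_continuous_image) (auto intro: continuous_on_subset)
    then show ?thesis unfolding bounded_iff by auto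
  qed
  obtain b where b: "\<And>y. y \<in> cball c R \<Longrightarrow> norm (DJ y) \<le> b" using ball_bdd[OF cont(1)] by blast
  have "\<forall>k\<in>K. \<exists>b. \<forall>y\<in>cball c R. norm (Dg k y) \<le> b" using ball_bdd[OF cont(3)] by blast
  then obtain bg where bg: "\<And>k y. k \<in> K \<Longrightarrow> y \<in> cball c R \<Longrightarrow> norm (Dg k y) \<le> bg k" by metis
  define B where "B = b + (\<Sum>k\<in>K. (u k + R) * bg k)"
  have "norm (vx t) \<le> B" if t: "t \<ge> 0" for t
  proof -
    have "norm (\<Sum>k\<in>K. lam t k *\<^sub>R Dg k (x t)) \<le> (\<Sum>k\<in>K. (u k + R) * bg k)"
    proof (rule sum_norm_le)
      fix k assume k: "k \<in> K"
      have "\<bar>lam t k\<bar> * norm (Dg k (x t)) \<le> (u k + R) * bg k"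
        using lam_bdd[OF k t] bg[OF k x_bdd[OF t]] by (intro mult_mono) auto
      then show "norm (lam t k *\<^sub>R Dg k (x t)) \<le> (u k + R) * bg k" by simp
    qed
    then show ?thesis
      unfolding vx_def B_def norm_minus_cancel using b[OF x_bdd[OF t]] by (intro norm_triangle_mono)
  qed
  then have "norm (x t - x s) \<le> B * (t - s)" if "0 \<le> s" "s \<le> t" for s t
    using has_velocity_norm_le[OF x[folded vx_def] that] that by auto
  then show ?thesis
    using dissipation_imp_tendsto[OF _ V V_nonneg dissip \<mu>] by auto
qed

section \<open>Load shedding as a convex program\<close>

lemma gradient_eq:
  assumes "GDERIV f x :> D"
  shows "gradient f x = D"
  unfolding gradient_def
proof (rule the_equality)
  fix D' assume "GDERIV f x :> D'"
  then have "(\<lambda>h. h \<bullet> D') = (\<lambda>h. h \<bullet> D)"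
    using assms unfolding gderiv_def by (rule has_derivative_unique)
  then have "h \<bullet> D' = h \<bullet> D" for h by (rule fun_cong)
  then show "D' = D" using vector_eq_ldot by blast
qed (rule assms)

lemma GDERIV_sum:
  assumes "\<And>k. k \<in> K \<Longrightarrow> GDERIV (f k) x :> D k"
  shows "GDERIV (\<lambda>y. \<Sum>k\<in>K. f k y) x :> (\<Sum>k\<in>K. D k)"
  using assms unfolding gderiv_def inner_sum_right by (intro has_derivative_sum) auto

lemma line_power_linear: 
  "line_power ginv A Y P i j =
    ((axis i 1 \<bullet> (nodal_matrix A Y *v axis j 1)) *\<^sub>R
      ((axis i 1 - axis j 1) v* ginv (nodal_matrix A Y))) \<bullet> P"
  by (simp add: line_power_def dot_lmul_matrix)

lemma inner_times_shift: "(w * y) \<bullet> z = y \<bullet> (w * z)" for w y z :: "real^'b"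
  by (simp add: inner_vec_def mult_ac)

lemma shedding_cost_expansion:
  "shedding_cost W P0 Q =
    shedding_cost W P0 P + (2 *\<^sub>R (W * (W * (P - P0)))) \<bullet> (Q - P) + (norm (W * (Q - P)))\<^sup>2"
proof -
  have "W * (Q - P0) = W * (P - P0) + W * (Q - P)" by (simp add: algebra_simps)
  then show ?thesis
    unfolding shedding_cost_def power2_norm_eq_inner
    using inner_times_shift[of W "W * (P - P0)" "Q - P"] inner_commute[of "W * (Q - P)" "W * (P - P0)"]
    by (simp add: inner_add_left inner_add_right)
qed

lemma bounded_linear_times_vec: "bounded_linear (\<lambda>z. w * z)" for w :: "real^'b"
  unfolding linear_conv_bounded_linear[symmetric]
  by (rule linearI) (simp_all add: vec_eq_iff algebra_simps)

lemma GDERIV_shedding_cost: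
  "GDERIV (shedding_cost W P0) P :> 2 *\<^sub>R (W * (W * (P - P0)))"
proof -
  have "((\<lambda>Q. W * (Q - P0)) has_derivative (\<lambda>h. W * h)) (at P)"
    by (rule bounded_linear.has_derivative[OF bounded_linear_times_vec])
      (auto intro!: derivative_eq_intros)
  then have "((\<lambda>Q. (W * (Q - P0)) \<bullet> (W * (Q - P0))) has_derivative
      (\<lambda>h. (W * (P - P0)) \<bullet> (W * h) + (W * h) \<bullet> (W * (P - P0)))) (at P)"
    using has_derivative_inner by blast
  moreover have "(W * (P - P0)) \<bullet> (W * h) + (W * h) \<bullet> (W * (P - P0))
      = h \<bullet> (2 *\<^sub>R (W * (W * (P - P0))))" for h
    using inner_times_shift[of W h "W * (P - P0)"] inner_commute[of "W * (P - P0)" "W * h"] by simp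
  ultimately show ?thesis
    unfolding gderiv_def shedding_cost_def power2_norm_eq_inner by simp
qed

lemma weighted_norm_ge:
  fixes W :: "real^'b::finite"
  assumes "\<And>i. W $ i \<noteq> 0"
  obtains \<mu> where "\<mu> > 0" "\<And>z. (norm (W * z))\<^sup>2 \<ge> \<mu> * (norm z)\<^sup>2"
proof
  define \<mu> where "\<mu> = Min (range (\<lambda>i. (W $ i)\<^sup>2))"
  show "\<mu> > 0" unfolding \<mu>_def using assms by auto
  show "(norm (W * z))\<^sup>2 \<ge> \<mu> * (norm z)\<^sup>2" for z
  proof -
    have "\<mu> * (z $ i)\<^sup>2 \<le> (W $ i)\<^sup>2 * (z $ i)\<^sup>2" for i
      unfolding \<mu>_def by (intro mult_right_mono) auto
    then have "(\<Sum>i\<in>UNIV. \<mu> * (z $ i)\<^sup>2) \<le> (\<Sum>i\<in>UNIV. (W $ i)\<^sup>2 * (z $ i)\<^sup>2)"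
      by (rule sum_mono)
    then show ?thesis
      unfolding power2_norm_eq_inner inner_vec_def
      by (simp add: sum_distrib_left power2_eq_square mult.assoc mult.left_commute)
  qed
qed

text \<open>One index type collects the line limits, the upper and the lower injection bounds, so that the
  three families of multipliers become one family, as in \<open>saddle_point_flow_converges\<close>.\<close>
definition constraints :: "('b \<times> 'b) set \<Rightarrow> (('b \<times> 'b) + 'b + 'b) set" where
  "constraints E = E <+> (UNIV <+> UNIV)"

definition constraint ::
  "('b \<Rightarrow> 'b \<Rightarrow> real^'b) \<Rightarrow> ('b \<Rightarrow> 'b \<Rightarrow> real) \<Rightarrow> real^'b \<Rightarrow> real^'b \<Rightarrow>
   ('b \<times> 'b) + 'b + 'b \<Rightarrow> real^'b::finite \<Rightarrow> real" where
  "constraint a cap lo hi k Q = (case k of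
     Inl (i, j) \<Rightarrow> (a i j \<bullet> Q)\<^sup>2 - (cap i j)\<^sup>2
   | Inr (Inl i) \<Rightarrow> Q $ i - hi $ i
   | Inr (Inr i) \<Rightarrow> lo $ i - Q $ i)"

definition constraint_gradient ::
  "('b \<Rightarrow> 'b \<Rightarrow> real^'b) \<Rightarrow> ('b \<times> 'b) + 'b + 'b \<Rightarrow> real^'b \<Rightarrow> real^'b::finite" where
  "constraint_gradient a k Q = (case k of
     Inl (i, j) \<Rightarrow> (2 * (a i j \<bullet> Q)) *\<^sub>R a i j
   | Inr (Inl i) \<Rightarrow> axis i 1
   | Inr (Inr i) \<Rightarrow> - axis i 1)"

definition multiplier ::
  "('b \<Rightarrow> 'b \<Rightarrow> real) \<Rightarrow> real^'b \<Rightarrow> real^'b \<Rightarrow> ('b \<times> 'b) + 'b + 'b \<Rightarrow> real" where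
  "multiplier lam tau_hi tau_lo k = (case k of
     Inl (i, j) \<Rightarrow> lam i j
   | Inr (Inl i) \<Rightarrow> tau_hi $ i
   | Inr (Inr i) \<Rightarrow> tau_lo $ i)"

lemma finite_constraints: "finite (constraints (E :: ('b::finite \<times> 'b) set))"
  unfolding constraints_def by (intro finite_Plus) auto

lemma constraints_cases:
  assumes "k \<in> constraints E"
  obtains i j where "k = Inl (i, j)" "(i, j) \<in> E" | i where "k = Inr (Inl i)" | i where "k = Inr (Inr i)"
  using assms unfolding constraints_def by (auto simp del: UNIV_Plus_UNIV elim!: PlusE)

lemma feasible_iff_constraints:
  "feasible E (\<lambda>Q i j. a i j \<bullet> Q) cap lo hi Q \<longleftrightarrow> (\<forall>k\<in>constraints E. constraint a cap lo hi k Q \<le> 0)"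
  unfolding constraints_def constraint_def feasible_def Plus_def ball_Un
  by (auto simp: ball_Un)

lemma lagrangian_eq_sum:
  "lagrangian E (\<lambda>Q i j. a i j \<bullet> Q) cap lo hi W P0 Q lam tau_hi tau_lo =
    shedding_cost W P0 Q +
    (\<Sum>k\<in>constraints E. multiplier lam tau_hi tau_lo k * constraint a cap lo hi k Q)"
  unfolding constraints_def lagrangian_def multiplier_def constraint_def
  by (simp add: sum.Plus case_prod_unfold del: UNIV_Plus_UNIV)

lemma GDERIV_constraint:
  "GDERIV (constraint a cap lo hi k) Q :> constraint_gradient a k Q"
proof -
  have comp: "((\<lambda>Q. Q $ i) has_derivative (\<lambda>h. h $ i)) (at Q)" for i
    by (rule bounded_linear.has_derivative[OF bounded_linear_vec_nth has_derivative_ident])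
  consider i j where "k = Inl (i, j)" | i where "k = Inr (Inl i)" | i where "k = Inr (Inr i)"
    by (metis obj_sumE surj_pair)
  then show ?thesis
  proof cases
    case 1
    then show ?thesis
      unfolding gderiv_def constraint_def constraint_gradient_def
      by (auto intro!: derivative_eq_intros simp: inner_commute)
  qed (auto simp: gderiv_def constraint_def[abs_def] constraint_gradient_def inner_axis
      intro!: derivative_eq_intros comp)
qed

lemma constraint_convex:
  "constraint a cap lo hi k Q \<ge> constraint a cap lo hi k P + constraint_gradient a k P \<bullet> (Q - P)"
proof (cases k)
  case (Inl p)
  obtain i j where "p = (i, j)" by (cases p)
  moreover have "0 \<le> (a i j \<bullet> Q - a i j \<bullet> P)\<^sup>2" by simp
  ultimately show ?thesis
    unfolding Inl constraint_def constraint_gradient_def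
    by (simp add: inner_diff_right power2_eq_square algebra_simps)
next
  case (Inr p)
  then show ?thesis
    by (cases p) (auto simp: constraint_def constraint_gradient_def inner_axis' )
qed

text \<open>For an active line limit put \<open>p = a i j \<bullet> P\<close> and \<open>q = a i j \<bullet> d\<close>. The constraint at \<open>P + h *\<^sub>R d\<close> is
  \<open>h * (2 * (p * q) + h * q\<^sup>2)\<close> with \<open>p * q \<le> 0\<close>. Since \<open>p\<^sup>2 = cap\<^sup>2 \<noteq> 0\<close>, either \<open>q = 0\<close> or the linear
  term is strictly negative and wins for small \<open>h\<close>. For a zero threshold the gradient would
  vanish and this could fail.\<close>
lemma constraint_qualification:
  assumes k: "k \<in> constraints E" and thresholds: "\<And>i j. (i, j) \<in> E \<Longrightarrow> cap i j \<noteq> 0"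
    and active: "constraint a cap lo hi k P = 0" and d: "d \<bullet> constraint_gradient a k P \<le> 0"
  shows "\<forall>\<^sub>F h in at_right 0. constraint a cap lo hi k (P + h *\<^sub>R d) \<le> 0"
  using k
proof (cases rule: constraints_cases)
  case (1 i j)
  define p q where "p = a i j \<bullet> P" and "q = a i j \<bullet> d"
  have p: "p\<^sup>2 = (cap i j)\<^sup>2" "p \<noteq> 0"
    using active thresholds[OF 1(2)] unfolding 1 p_def constraint_def by auto
  have pq: "p * q \<le> 0"
    using d unfolding 1 p_def q_def constraint_gradient_def by (simp add: inner_commute)
  have val: "constraint a cap lo hi k (P + h *\<^sub>R d) = h * (2 * (p * q) + h * q\<^sup>2)" for h
    using p(1) unfolding 1 constraint_def p_def q_def
    by (simp add: inner_add_right power2_eq_square algebra_simps)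
  show ?thesis
  proof (cases "q = 0")
    case True
    then show ?thesis unfolding val by simp
  next
    case False
    then have "2 * (p * q) < 0" using pq p(2) by (simp add: order.strict_iff_order)
    moreover have "((\<lambda>h. 2 * (p * q) + h * q\<^sup>2) \<longlongrightarrow> 2 * (p * q) + 0 * q\<^sup>2) (at_right 0)"
      by (intro tendsto_intros)
    ultimately have "\<forall>\<^sub>F h in at_right 0. 2 * (p * q) + h * q\<^sup>2 < 0"
      using order_tendstoD(2) by fastforce
    moreover have "\<forall>\<^sub>F h in at_right (0::real). 0 < h" by (rule eventually_at_right_less)
    ultimately show ?thesis
      unfolding val by eventually_elim (simp add: mult_pos_neg less_imp_le)
  qed
next
  case (2 i)
  have "\<forall>\<^sub>F h in at_right (0::real). 0 < h" by (rule eventually_at_right_less)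
  then show ?thesis
    by eventually_elim
      (use active d in \<open>simp add: 2 constraint_def constraint_gradient_def inner_axis mult_nonneg_nonpos\<close>)
next
  case (3 i)
  have "\<forall>\<^sub>F h in at_right (0::real). 0 < h" by (rule eventually_at_right_less)
  then show ?thesis
    by eventually_elim
      (use active d in \<open>simp add: 3 constraint_def constraint_gradient_def inner_axis\<close>)
qed

lemma continuous_constraint: "continuous_on S (constraint a cap lo hi k)"
  using GDERIV_constraint unfolding gderiv_def
  by (meson continuous_at_imp_continuous_on has_derivative_continuous)

lemma continuous_constraint_gradient: "continuous_on S (constraint_gradient a k)"
proof (cases k)
  case (Inl p)
  then show ?thesis
    by (cases p) (auto simp: constraint_gradient_def[abs_def] intro!: continuous_intros)
next
  case (Inr p)
  then show ?thesis
    by (cases p) (auto simp: constraint_gradient_def[abs_def])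
qed

lemma gradient_lagrangian:
  "gradient (\<lambda>Q. lagrangian E (\<lambda>Q i j. a i j \<bullet> Q) cap lo hi W P0 Q lam tau_hi tau_lo) P =
    2 *\<^sub>R (W * (W * (P - P0))) +
    (\<Sum>k\<in>constraints E. multiplier lam tau_hi tau_lo k *\<^sub>R constraint_gradient a k P)"
proof (rule gradient_eq)
  have "GDERIV (\<lambda>Q. multiplier lam tau_hi tau_lo k * constraint a cap lo hi k Q) P
      :> multiplier lam tau_hi tau_lo k *\<^sub>R constraint_gradient a k P" for k
    using has_derivative_mult_right[OF GDERIV_constraint[unfolded gderiv_def]]
    unfolding gderiv_def inner_scaleR_right .
  then show "GDERIV (\<lambda>Q. lagrangian E (\<lambda>Q i j. a i j \<bullet> Q) cap lo hi W P0 Q lam tau_hi tau_lo) P :>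
      2 *\<^sub>R (W * (W * (P - P0))) +
      (\<Sum>k\<in>constraints E. multiplier lam tau_hi tau_lo k *\<^sub>R constraint_gradient a k P)"
    unfolding lagrangian_eq_sum
    by (rule GDERIV_add[OF GDERIV_shedding_cost GDERIV_sum])
qed

lemma shedding_minimizer_exists:
  assumes "\<exists>P. feasible E (\<lambda>Q i j. a i j \<bullet> Q) cap lo hi P"
  obtains P where "feasible E (\<lambda>Q i j. a i j \<bullet> Q) cap lo hi P"
    "\<And>Q. feasible E (\<lambda>Q i j. a i j \<bullet> Q) cap lo hi Q \<Longrightarrow> shedding_cost W P0 P \<le> shedding_cost W P0 Q"
proof -
  define S where "S = {Q. feasible E (\<lambda>Q i j. a i j \<bullet> Q) cap lo hi Q}"
  have "S = (\<Inter>k\<in>constraints E. {Q. constraint a cap lo hi k Q \<le> 0})"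
    unfolding S_def feasible_iff_constraints by auto
  moreover have "closed {Q. constraint a cap lo hi k Q \<le> 0}" for k
    by (intro closed_Collect_le continuous_constraint continuous_intros)
  ultimately have "closed S" by auto
  moreover have "S \<subseteq> cbox lo hi" unfolding S_def feasible_def by (auto simp: mem_box_cart)
  ultimately have "compact S" by (metis bounded_cbox bounded_subset compact_eq_bounded_closed)
  moreover have "S \<noteq> {}" using assms unfolding S_def by auto
  moreover have "continuous_on S (shedding_cost W P0)"
    using GDERIV_shedding_cost unfolding gderiv_def
    by (meson continuous_at_imp_continuous_on has_derivative_continuous)
  ultimately obtain P where "P \<in> S" "\<forall>Q\<in>S. shedding_cost W P0 P \<le> shedding_cost W P0 Q"
    using continuous_attains_inf by metis
  then show thesis using that unfolding S_def by auto
qed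

section \<open>Convergence to the optimal load shedding\<close>

theorem proposition3p4:
  fixes src tgt :: "'n::finite \<Rightarrow> 'b::finite"
    and E :: "('b \<times> 'b) set"
    and ginv :: "real^'b^'b \<Rightarrow> real^'b^'b"
    and Y0 d :: "real^'n"
    and c cap :: "'b \<Rightarrow> 'b \<Rightarrow> real"
    and s :: real
    and m :: nat
    and P0 W lo hi :: "real^'b"
    and F :: "real^'b \<Rightarrow> 'b \<Rightarrow> 'b \<Rightarrow> real"
  assumes branches: "\<And>l. src l \<noteq> tgt l"
    and pairs: "connected_pairs src tgt E"
    and step: "m \<ge> 1"
    and slope: "s > 0"
    and flow: "\<And>P i j. F P i j =
      line_power ginv (incidence_matrix src tgt) (admittance ginv src tgt c s P0 Y0 d m) P i j"
    and weights: "\<And>i. W $ i \<noteq> 0"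
    and thresholds: "\<And>i j. (i, j) \<in> E \<Longrightarrow> cap i j \<noteq> 0"
    and nonempty: "\<exists>P. feasible E F cap lo hi P"
  shows "\<exists>Popt.
    (\<forall>Q. is_arg_min (shedding_cost W P0) (feasible E F cap lo hi) Q \<longleftrightarrow> Q = Popt) \<and>
    (\<forall>P lam tau_hi tau_lo.
       saddle_point_dynamics E F cap lo hi W P0 P lam tau_hi tau_lo \<longrightarrow>
       (\<forall>(i, j)\<in>E. lam 0 i j \<ge> 0) \<longrightarrow>
       (\<forall>i. tau_hi 0 $ i \<ge> 0 \<and> tau_lo 0 $ i \<ge> 0) \<longrightarrow>
       (P \<longlongrightarrow> Popt) at_top)"
proof -
  define N where "N = nodal_matrix (incidence_matrix src tgt) (admittance ginv src tgt c s P0 Y0 d m)"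
  define a where "a i j = (axis i 1 \<bullet> (N *v axis j 1)) *\<^sub>R ((axis i 1 - axis j 1) v* ginv N)" for i j
  have F: "F = (\<lambda>Q i j. a i j \<bullet> Q)"
    by (intro ext) (simp only: flow line_power_linear a_def N_def)
  define K where "K = constraints E"
  define g where "g = constraint a cap lo hi"
  define Dg where "Dg = constraint_gradient a"
  define DJ where "DJ P = 2 *\<^sub>R (W * (W * (P - P0)))" for P
  obtain \<mu> where \<mu>: "\<mu> > 0" "\<And>z. (norm (W * z))\<^sup>2 \<ge> \<mu> * (norm z)\<^sup>2"
    using weighted_norm_ge[of W] weights by blast
  have feas_iff: "feasible E F cap lo hi Q \<longleftrightarrow> (\<forall>k\<in>K. g k Q \<le> 0)" for Q
    unfolding F K_def g_def by (rule feasible_iff_constraints)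
  obtain Popt where Popt: "feasible E F cap lo hi Popt"
    "\<And>Q. feasible E F cap lo hi Q \<Longrightarrow> shedding_cost W P0 Popt \<le> shedding_cost W P0 Q"
    using shedding_minimizer_exists[of E a cap lo hi] nonempty unfolding F by blast
  have g_conv: "g k Q \<ge> g k P + Dg k P \<bullet> (Q - P)" for k P Q
    unfolding g_def Dg_def by (rule constraint_convex)
  have g_cont: "continuous_on UNIV (g k)" for k unfolding g_def by (rule continuous_constraint)
  obtain u where u: "\<And>k. u k \<ge> 0" "\<And>k. k \<in> K \<Longrightarrow> u k * g k Popt = 0"
    "DJ Popt + (\<Sum>k\<in>K. u k *\<^sub>R Dg k Popt) = 0"
  proof (rule kkt_multipliers[of K g Popt "shedding_cost W P0" "DJ Popt" "\<lambda>k. Dg k Popt"])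
    show "finite K" unfolding K_def by (rule finite_constraints)
    show "GDERIV (shedding_cost W P0) Popt :> DJ Popt" unfolding DJ_def by (rule GDERIV_shedding_cost)
    show "isCont (g k) Popt" for k using g_cont[of k] by (simp add: continuous_on_eq_continuous_at)
    show "\<forall>\<^sub>F h in at_right 0. g k (Popt + h *\<^sub>R d) \<le> 0"
      if "k \<in> K" "g k Popt = 0" "d \<bullet> Dg k Popt \<le> 0" for k d
      using constraint_qualification[of k E cap] thresholds that unfolding K_def g_def Dg_def by auto
    show "g k Popt \<le> 0" if "k \<in> K" for k using Popt(1) that unfolding feas_iff by blast
    show "shedding_cost W P0 Popt \<le> shedding_cost W P0 y" if "\<And>k. k \<in> K \<Longrightarrow> g k y \<le> 0" for y
      using Popt(2)[of y] that unfolding feas_iff by blast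
  qed (rule that)
  have unique: "is_arg_min (shedding_cost W P0) (feasible E F cap lo hi) Q \<longleftrightarrow> Q = Popt" for Q
  proof
    assume "is_arg_min (shedding_cost W P0) (feasible E F cap lo hi) Q"
    then have Q: "feasible E F cap lo hi Q" "shedding_cost W P0 Q \<le> shedding_cost W P0 Popt"
      using Popt(1) unfolding is_arg_min_def by (auto simp: not_less)
    have "DJ Popt \<bullet> (Q - Popt) \<ge> 0"
      using kkt_imp_variational_inequality[of K g Popt "\<lambda>k. Dg k Popt" Q u "DJ Popt"] g_conv u Q(1)
      unfolding feas_iff by blast
    then have "(norm (W * (Q - Popt)))\<^sup>2 \<le> 0"
      using shedding_cost_expansion[of W P0 Q Popt] Q(2) unfolding DJ_def by linarith
    then have "\<mu> * (norm (Q - Popt))\<^sup>2 \<le> 0" using \<mu>(2)[of "Q - Popt"] by linarith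
    then show "Q = Popt" using \<mu>(1) by (simp add: mult_le_0_iff)
  next
    assume "Q = Popt"
    then show "is_arg_min (shedding_cost W P0) (feasible E F cap lo hi) Q"
      using Popt unfolding is_arg_min_def by (auto simp: not_less)
  qed
  have conv: "(P \<longlongrightarrow> Popt) at_top"
    if dyn: "saddle_point_dynamics E F cap lo hi W P0 P lam tau_hi tau_lo"
      and init: "\<forall>(i, j)\<in>E. lam 0 i j \<ge> 0" "\<forall>i. tau_hi 0 $ i \<ge> 0 \<and> tau_lo 0 $ i \<ge> 0"
    for P lam tau_hi tau_lo
  proof -
    have P_vel: "has_velocity P
        (\<lambda>t. - gradient (\<lambda>Q. lagrangian E F cap lo hi W P0 Q (lam t) (tau_hi t) (tau_lo t)) (P t))"
      and lam_vel: "\<forall>(i, j)\<in>E. has_velocity (\<lambda>t. lam t i j)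
        (\<lambda>t. plus_proj ((F (P t) i j)\<^sup>2 - (cap i j)\<^sup>2) (lam t i j))"
      and hi_vel: "\<And>i. has_velocity (\<lambda>t. tau_hi t $ i) (\<lambda>t. plus_proj (P t $ i - hi $ i) (tau_hi t $ i))"
      and lo_vel: "\<And>i. has_velocity (\<lambda>t. tau_lo t $ i) (\<lambda>t. plus_proj (lo $ i - P t $ i) (tau_lo t $ i))"
      using dyn unfolding saddle_point_dynamics_def by simp_all
    define L where "L t = multiplier (lam t) (tau_hi t) (tau_lo t)" for t :: real
    show ?thesis
    proof (rule saddle_point_flow_converges[of K "2 * \<mu>" DJ g Dg Popt u P L])
      show "finite K" unfolding K_def by (rule finite_constraints)
      show "(DJ y - DJ z) \<bullet> (y - z) \<ge> 2 * \<mu> * (norm (y - z))\<^sup>2" for y z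
      proof -
        have "DJ y - DJ z = 2 *\<^sub>R (W * (W * (y - z)))"
          unfolding DJ_def by (simp add: algebra_simps)
        then have "(DJ y - DJ z) \<bullet> (y - z) = 2 * (norm (W * (y - z)))\<^sup>2"
          by (simp add: power2_norm_eq_inner inner_times_shift[of W "W * (y - z)"])
        then show ?thesis using \<mu>(2)[of "y - z"] by simp
      qed
      show "continuous_on UNIV DJ"
        unfolding DJ_def
        by (intro continuous_intros bounded_linear.continuous_on[OF bounded_linear_times_vec])
      show "continuous_on UNIV (Dg k)" for k
        unfolding Dg_def by (rule continuous_constraint_gradient)
      show "has_velocity P (\<lambda>t. - (DJ (P t) + (\<Sum>k\<in>K. L t k *\<^sub>R Dg k (P t))))"
        using P_vel unfolding F gradient_lagrangian DJ_def K_def L_def Dg_def .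
      show "has_velocity (\<lambda>t. L t k) (\<lambda>t. plus_proj (g k (P t)) (L t k))" if "k \<in> K" for k
        using that unfolding K_def
      proof (cases rule: constraints_cases)
        case (1 i j)
        then show ?thesis
          using lam_vel unfolding L_def g_def multiplier_def constraint_def F by auto
      qed (use hi_vel lo_vel in \<open>simp_all add: L_def g_def multiplier_def constraint_def\<close>)
      show "L 0 k \<ge> 0" if "k \<in> K" for k
        using that unfolding K_def
      proof (cases rule: constraints_cases)
        case (1 i j)
        then show ?thesis using init(1) unfolding L_def multiplier_def by auto
      qed (use init(2) in \<open>simp_all add: L_def multiplier_def\<close>)
      show "g k Popt \<le> 0" if "k \<in> K" for k using Popt(1) that unfolding feas_iff by blast
      show "2 * \<mu> > 0" using \<mu>(1) by simp
    qed (rule g_conv g_cont u | assumption)+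
  qed
  show ?thesis using unique conv by blast
qed

end
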